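(* Let $q=(q_1,\dots,q_n)\in(\mathbb{R}^3)^n$, $q_i=(x_i,y_i,z_i)$, together with positive masses $m=(m_1,\dots,m_n)$, be a normalized central configuration satisfying $y_{n-1}=z_{n-1}=z_{n-2}=0$. Case 1. If $x_{n-1}=x_n$ or $x_{n-1}=0$, then $(q,m)$ is a degenerate solution of the reduced system $\mathcal{RS}$ (in dimension $d=3$). Case 2. If $y_{n-2}=0$ and $(q,m)$ is non-collinear, then $(q,m)$ is a degenerate solution of $\mathcal{RS}$. Case 3. If $$\det\begin{bmatrix} y_{n-2}-y_n & y_{n-1}-y_n\\ x_{n-2}-x_n & x_{n-1}-x_n\end{bmatrix}=0$$ and $(q,m)$ is non-collinear, then $(q,m)$ is a degenerate solution of $\mathcal{RS}$.
   Context: Let $n\ge 3$, masses $m_i>0$, positions $q_i=(x_i,y_i,z_i)\in\mathbb{R}^3$ pairwise distinct, $r_{ij}=|q_i-q_j|$. Define $F_i(q_1,\dots,q_n)=q_i-\sum_{j\ne i}\frac{m_j}{r_{ij}^3}(q_i-q_j)$ for $i=1,\dots,n$. A normalized central configuration is $(q,m)$ with $F_i(q)=0$ for all $i$ (this forces $\sum_i m_iq_i=0$). Collinear means that all $q_i$ lie on one line. Center of mass reduction: $q_n(q_1,\dots,q_{n-1})=-\frac1{m_n}\sum_{i=1}^{n-1}m_iq_i$, and $F^{\mathrm{red}}_i(q_1,\dots,q_{n-1})=F_i(q_1,\dots,q_{n-1},q_n(q_1,\dots,q_{n-1}))$ for $i=1,\dots,n-1$, with components $F^{\mathrm{red}}_i=(F^{\mathrm{red}}_{i,x},F^{\mathrm{red}}_{i,y},F^{\mathrm{red}}_{i,z})$.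 Reduced system $\mathcal{RS}$ for $d=3$: the $3n-6$ equations $F^{\mathrm{red}}_i=0$ ($i=1,\dots,n-3$), $F^{\mathrm{red}}_{n-2,x}=0$, $F^{\mathrm{red}}_{n-2,y}=0$, $F^{\mathrm{red}}_{n-1,x}=0$ in the $3n-6$ real unknowns $(q_1,\dots,q_{n-3},x_{n-2},y_{n-2},x_{n-1})$, where $z_{n-2}=y_{n-1}=z_{n-1}=0$ is imposed. A configuration $(q,m)$ is a solution of $\mathcal{RS}$ if these equations hold, $z_{n-2}=y_{n-1}=z_{n-1}=0$ and $q_n=q_n(q_1,\dots,q_{n-1})$. It is a non-degenerate solution if the $(3n-6)\times(3n-6)$ Jacobian matrix of the left-hand sides with respect to these unknowns is invertible at it, and a degenerate solution otherwise. *)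

theory Defs
  imports "HOL-Analysis.Analysis" "Jordan_Normal_Form.Matrix"
begin

(* "$" is kept for the components of vectors in real^3 only. *)
no_notation vec_index (infixl "$" 100)

(* Bodies are indexed by {1..n}; the values of q and m outside {1..n} are irrelevant.
   The components q i $ 1, q i $ 2, q i $ 3 are x_i, y_i, z_i. *)

definition is_configuration :: "nat \<Rightarrow> (nat \<Rightarrow> real^3) \<Rightarrow> (nat \<Rightarrow> real) \<Rightarrow> bool" where
  "is_configuration n q m \<longleftrightarrow> (\<forall>i\<in>{1..n}. m i > 0) \<and> inj_on q {1..n}"

definition F :: "nat \<Rightarrow> (nat \<Rightarrow> real) \<Rightarrow> (nat \<Rightarrow> real^3) \<Rightarrow> nat \<Rightarrow> real^3" where
  "F n m q i = q i - (\<Sum>j\<in>{1..n} - {i}. (m j / norm (q i - q j) ^ 3) *\<^sub>R (q i - q j))"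

definition normalized_central_configuration ::
    "nat \<Rightarrow> (nat \<Rightarrow> real^3) \<Rightarrow> (nat \<Rightarrow> real) \<Rightarrow> bool" where
  "normalized_central_configuration n q m \<longleftrightarrow>
     is_configuration n q m \<and> (\<forall>i\<in>{1..n}. F n m q i = 0)"

definition last_body :: "nat \<Rightarrow> (nat \<Rightarrow> real) \<Rightarrow> (nat \<Rightarrow> real^3) \<Rightarrow> real^3" where
  "last_body n m q = - (1 / m n) *\<^sub>R (\<Sum>i\<in>{1..n-1}. m i *\<^sub>R q i)"

definition F_red :: "nat \<Rightarrow> (nat \<Rightarrow> real) \<Rightarrow> (nat \<Rightarrow> real^3) \<Rightarrow> nat \<Rightarrow> real^3" where
  "F_red n m q i = F n m (q(n := last_body n m q)) i"

(* The pair (i, c) stands both for the unknown q i $ c and for the equation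
   F_red n m q i $ c = 0: the reduced system keeps the same pairs in both roles. *)
definition rs_slots :: "nat \<Rightarrow> (nat \<times> 3) list" where
  "rs_slots n = concat (map (\<lambda>i. [(i, 1), (i, 2), (i, 3)]) [1..<n-2])
                @ [(n-2, 1), (n-2, 2), (n-1, 1)]"

lemma length_rs_slots:
  assumes "n \<ge> 3"
  shows "length (rs_slots n) = 3 * n - 6"
proof -
  have "length (concat (map (\<lambda>i. [(i, 1::3), (i, 2), (i, 3)]) xs)) = 3 * length xs" for xs :: "nat list"
    by (induction xs) auto
  then show ?thesis
    using assms by (simp add: rs_slots_def)
qed

(* Bodies 1..n-1 with the given values of the unknowns and with
   z_{n-2} = y_{n-1} = z_{n-1} = 0; body n is supplied by F_red. *)
definition rs_embed :: "nat \<Rightarrow> (nat \<times> 3 \<Rightarrow> real) \<Rightarrow> nat \<Rightarrow> real^3" where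
  "rs_embed n u = (\<lambda>i. \<chi> c. if (i, c) \<in> set (rs_slots n) then u (i, c) else 0)"

definition rs_lhs :: "nat \<Rightarrow> (nat \<Rightarrow> real) \<Rightarrow> (nat \<times> 3 \<Rightarrow> real) \<Rightarrow> nat \<times> 3 \<Rightarrow> real" where
  "rs_lhs n m u = (\<lambda>(i, c). F_red n m (rs_embed n u) i $ c)"

(* Entry (k, l) is the partial derivative of the k-th left-hand side
   with respect to the l-th unknown. *)
definition rs_jacobian :: "nat \<Rightarrow> (nat \<Rightarrow> real) \<Rightarrow> (nat \<times> 3 \<Rightarrow> real) \<Rightarrow> real mat" where
  "rs_jacobian n m u = Matrix.mat (3 * n - 6) (3 * n - 6)
     (\<lambda>(k, l). deriv (\<lambda>t. rs_lhs n m (u(rs_slots n ! l := t)) (rs_slots n ! k)) (u (rs_slots n ! l)))"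

definition coords :: "(nat \<Rightarrow> real^3) \<Rightarrow> nat \<times> 3 \<Rightarrow> real" where
  "coords q = (\<lambda>(i, c). q i $ c)"

definition rs_solution :: "nat \<Rightarrow> (nat \<Rightarrow> real^3) \<Rightarrow> (nat \<Rightarrow> real) \<Rightarrow> bool" where
  "rs_solution n q m \<longleftrightarrow>
     is_configuration n q m \<and>
     (\<forall>s\<in>set (rs_slots n). rs_lhs n m (coords q) s = 0) \<and>
     q (n-2) $ 3 = 0 \<and> q (n-1) $ 2 = 0 \<and> q (n-1) $ 3 = 0 \<and>
     q n = last_body n m q"

definition nondegenerate_rs_solution :: "nat \<Rightarrow> (nat \<Rightarrow> real^3) \<Rightarrow> (nat \<Rightarrow> real) \<Rightarrow> bool" where
  "nondegenerate_rs_solution n q m \<longleftrightarrow>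
     rs_solution n q m \<and> invertible_mat (rs_jacobian n m (coords q))"

definition degenerate_rs_solution :: "nat \<Rightarrow> (nat \<Rightarrow> real^3) \<Rightarrow> (nat \<Rightarrow> real) \<Rightarrow> bool" where
  "degenerate_rs_solution n q m \<longleftrightarrow>
     rs_solution n q m \<and> \<not> nondegenerate_rs_solution n q m"

end

theory Submission
  imports Defs
begin

text \<open>
  The forces are equivariant under rotations. At a central configuration, where \<open>F\<close> vanishes, every
  infinitesimal rotation \<open>q\<^sub>j \<mapsto> \<omega> \<times> q\<^sub>j\<close> therefore lies in the kernel of the linearization
  of \<open>F\<close> (\<open>linearized_F_rotation\<close>). The reduced system excludes these directions by
  dropping the three coordinates \<open>z\<^sub>n\<^sub>-\<^sub>2\<close>, \<open>y\<^sub>n\<^sub>-\<^sub>1\<close>, \<open>z\<^sub>n\<^sub>-\<^sub>1\<close>, once as unknowns and once as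
  equations, and either of the two can fail to do its job.

  \<^item> Unknowns: if some rotation field has vanishing dropped coordinates, it is a motion of the
    remaining unknowns, and its coordinates form a kernel vector of the Jacobian matrix
    (\<open>degenerate_if_gauge_fixed_rotation\<close>). The rotation about the z-axis is such a field if
    \<open>x\<^sub>n\<^sub>-\<^sub>1 = 0\<close>, for then \<open>q\<^sub>n\<^sub>-\<^sub>1 = 0\<close>; the rotation about the x-axis is one if \<open>y\<^sub>n\<^sub>-\<^sub>2 = 0\<close>.

  \<^item> Equations: the linearization is self-adjoint for the inner product weighted by the masses
    (\<open>linearized_F_selfadjoint\<close>), so rotation fields are also orthogonal to its image. On motions that
    keep the centre of mass at the origin, constant fields are orthogonal to the image as well. Hence
    the field \<open>\<eta> \<times> (q\<^sub>j - q\<^sub>n)\<close>, which does not involve the eliminated body \<open>n\<close>, gives a linear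
    dependency between the rows of the linearized forces; it linearizes the identity that the
    total torque about \<open>q\<^sub>n\<close> is zero. If its dropped coordinates vanish, it only involves rows that are kept and is
    a left kernel vector of the Jacobian matrix (\<open>degenerate_if_gauge_fixed_torque\<close>). This happens for
    the z-axis if \<open>x\<^sub>n\<^sub>-\<^sub>1 = x\<^sub>n\<close>, and for the axis \<open>\<eta> = q\<^sub>n\<^sub>-\<^sub>1 - q\<^sub>n\<close> if the determinant in the
    third case vanishes.

  The remaining point is that the fields are not zero. For the z-axis, this holds because
  \<open>q\<^sub>n\<^sub>-\<^sub>2\<close> and \<open>q\<^sub>n\<^sub>-\<^sub>1\<close> are distinct points of the plane \<open>z = 0\<close>; in the other two cases a
  vanishing field would put all bodies on one line, against non-collinearity.
\<close>

unbundle cross3_syntax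

section \<open>The linearized force\<close>

text \<open>The derivative of \<open>r \<mapsto> r / |r|\<^sup>3\<close> in direction \<open>x\<close>.\<close>
definition inverse_cube_deriv :: "real^3 \<Rightarrow> real^3 \<Rightarrow> real^3" where
  "inverse_cube_deriv r x = (1 / norm r ^ 3) *\<^sub>R x - (3 * inner r x / norm r ^ 5) *\<^sub>R r"

lemma linear_inverse_cube_deriv: "linear (inverse_cube_deriv r)"
  by (rule linearI)
     (simp_all add: inverse_cube_deriv_def inner_add_right algebra_simps add_divide_distrib)

lemma inverse_cube_deriv_minus_left: "inverse_cube_deriv (- r) x = inverse_cube_deriv r x"
  by (simp add: inverse_cube_deriv_def)

lemma inverse_cube_deriv_selfadjoint:
  "inner (inverse_cube_deriv r x) y = inner x (inverse_cube_deriv r y)"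
  by (simp add: inverse_cube_deriv_def inner_diff_left inner_diff_right inner_commute)

lemma inverse_cube_has_vector_derivative:
  assumes "r \<noteq> 0"
  shows "((\<lambda>t. (1 / norm (r + (t - a) *\<^sub>R x) ^ 3) *\<^sub>R (r + (t - a) *\<^sub>R x))
           has_vector_derivative inverse_cube_deriv r x) (at a)"
proof -
  have line: "((\<lambda>t. r + (t - a) *\<^sub>R x) has_vector_derivative x) (at a)"
    by (auto intro!: derivative_eq_intros)
  have "(norm has_derivative (\<lambda>h. inner h (sgn r))) (at (r + (a - a) *\<^sub>R x))"
    using has_derivative_norm[OF assms] by simp
  from diff_chain_at[OF line[unfolded has_vector_derivative_def] this]
  have norm: "((\<lambda>t. norm (r + (t - a) *\<^sub>R x)) has_real_derivative inner x (sgn r)) (at a)"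
    by (simp add: o_def has_field_derivative_def mult_commute_abs)
  have "((\<lambda>t. 1 / norm (r + (t - a) *\<^sub>R x) ^ 3) has_real_derivative - (3 * inner r x / norm r ^ 5)) (at a)"
    apply (rule derivative_eq_intros norm refl)+
    using assms apply simp
    using assms apply (simp add: sgn_div_norm inner_commute divide_simps)
    apply (simp add: eval_nat_numeral)
    done
  from has_vector_derivative_scaleR[OF this line] show ?thesis
    by (simp add: inverse_cube_deriv_def)
qed

text \<open>The derivative of \<open>F n m\<close> at \<open>q\<close> in direction \<open>w\<close>. The summand with \<open>j = i\<close> is zero; summing over
  all \<open>j\<close> makes the double sums below symmetric.\<close>
definition linearized_F ::
    "nat \<Rightarrow> (nat \<Rightarrow> real) \<Rightarrow> (nat \<Rightarrow> real^3) \<Rightarrow> (nat \<Rightarrow> real^3) \<Rightarrow> nat \<Rightarrow> real^3" where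
  "linearized_F n m q w i =
     w i - (\<Sum>j\<in>{1..n}. m j *\<^sub>R inverse_cube_deriv (q i - q j) (w i - w j))"

lemma F_eq_sum_all: "i \<in> {1..n} \<Longrightarrow> F n m q i = q i - (\<Sum>j\<in>{1..n}. m j *\<^sub>R ((1 / norm (q i - q j) ^ 3) *\<^sub>R (q i - q j)))"
  by (subst sum.remove[of _ i]) (simp_all add: F_def)

lemma F_has_vector_derivative:
  assumes "inj_on q {1..n}" "i \<in> {1..n}"
  shows "((\<lambda>t. F n m (\<lambda>j. q j + (t - a) *\<^sub>R w j) i) has_vector_derivative linearized_F n m q w i) (at a)"
proof -
  have pair: "((\<lambda>t. m j *\<^sub>R ((1 / norm (q i + (t - a) *\<^sub>R w i - (q j + (t - a) *\<^sub>R w j)) ^ 3)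
                 *\<^sub>R (q i + (t - a) *\<^sub>R w i - (q j + (t - a) *\<^sub>R w j))))
          has_vector_derivative m j *\<^sub>R inverse_cube_deriv (q i - q j) (w i - w j)) (at a)"
    if j: "j \<in> {1..n}" for j
  proof (cases "j = i")
    case True
    then show ?thesis by (simp add: inverse_cube_deriv_def)
  next
    case False
    with j assms have "q i - q j \<noteq> 0" by (auto dest: inj_onD)
    note * = has_vector_derivative_scaleR[OF DERIV_const inverse_cube_has_vector_derivative[OF this]]
    have "q i + (t - a) *\<^sub>R w i - (q j + (t - a) *\<^sub>R w j) = (q i - q j) + (t - a) *\<^sub>R (w i - w j)" for t
      by (simp add: algebra_simps)
    then have line: "(\<lambda>t. q i + (t - a) *\<^sub>R w i - (q j + (t - a) *\<^sub>R w j))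
        = (\<lambda>t. (q i - q j) + (t - a) *\<^sub>R (w i - w j))"
      by blast
    have "((\<lambda>t. m j *\<^sub>R ((1 / norm ((q i - q j) + (t - a) *\<^sub>R (w i - w j)) ^ 3)
        *\<^sub>R ((q i - q j) + (t - a) *\<^sub>R (w i - w j))))
        has_vector_derivative m j *\<^sub>R inverse_cube_deriv (q i - q j) (w i - w j)) (at a)"
      using *[of "m j" a "w i - w j"] by simp
    then show ?thesis
      unfolding line[THEN fun_cong] .
  qed
  have "((\<lambda>t. q i + (t - a) *\<^sub>R w i) has_vector_derivative w i) (at a)"
    by (auto intro!: derivative_eq_intros)
  then show ?thesis
    unfolding F_eq_sum_all[OF assms(2)] linearized_F_def
    by (intro has_vector_derivative_diff has_vector_derivative_sum pair)
qed

lemma linearized_F_sum: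
  "linearized_F n m q (\<lambda>j. \<Sum>s\<in>S. a s *\<^sub>R w s j) i = (\<Sum>s\<in>S. a s *\<^sub>R linearized_F n m q (w s) i)"
proof -
  have "inverse_cube_deriv (q i - q j) ((\<Sum>s\<in>S. a s *\<^sub>R w s i) - (\<Sum>s\<in>S. a s *\<^sub>R w s j))
      = (\<Sum>s\<in>S. a s *\<^sub>R inverse_cube_deriv (q i - q j) (w s i - w s j))" for j
    by (simp add: linear_sum[OF linear_inverse_cube_deriv] linear_cmul[OF linear_inverse_cube_deriv]
        flip: sum_subtractf scaleR_diff_right)
  then show ?thesis
    by (simp add: linearized_F_def scaleR_right_diff_distrib sum_subtractf scaleR_sum_right
        sum.swap[of _ S] mult.commute)
qed

lemma linearized_F_translation: "linearized_F n m q (\<lambda>_. c) i = c"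
  by (simp add: linearized_F_def inverse_cube_deriv_def)

lemma linearized_F_diff:
  "linearized_F n m q (\<lambda>j. v j - w j) i = linearized_F n m q v i - linearized_F n m q w i"
proof -
  have "inverse_cube_deriv (q i - q j) (v i - w i - (v j - w j))
      = inverse_cube_deriv (q i - q j) (v i - v j) - inverse_cube_deriv (q i - q j) (w i - w j)" for j
    by (simp flip: linear_diff[OF linear_inverse_cube_deriv] add: algebra_simps)
  then show ?thesis
    by (simp add: linearized_F_def scaleR_right_diff_distrib sum_subtractf)
qed

text \<open>Infinitesimal equivariance: a rotation moves each difference \<open>q\<^sub>i - q\<^sub>j\<close> orthogonally to itself, so
  the derivative of \<open>1 / r\<^sub>i\<^sub>j\<^sup>3\<close> does not contribute and only the direction of the force turns.\<close>
lemma linearized_F_rotation: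
  assumes "i \<in> {1..n}"
  shows "linearized_F n m q (\<lambda>j. \<omega> \<times> q j) i = \<omega> \<times> F n m q i"
proof -
  have "inverse_cube_deriv (q i - q j) (\<omega> \<times> q i - \<omega> \<times> q j)
      = \<omega> \<times> ((1 / norm (q i - q j) ^ 3) *\<^sub>R (q i - q j))" for j
    by (simp add: inverse_cube_deriv_def dot_cross_self cross_mult_right flip: Cross3.right_diff_distrib)
  moreover have "\<omega> \<times> sum f A = (\<Sum>j\<in>A. \<omega> \<times> f j)" for f :: "nat \<Rightarrow> real^3" and A
    by (induction A rule: infinite_finite_induct) (simp_all add: cross_add_right)
  ultimately show ?thesis
    by (simp add: linearized_F_def F_eq_sum_all[OF assms] Cross3.right_diff_distrib cross_mult_right)
qed

text \<open>The linearized force is the Hessian of a potential, up to the masses. Concretely, exchanging the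
  two bodies of each pair turns the interaction part into the sum over pairs of a symmetric bilinear form in
  the differences \<open>w\<^sub>i - w\<^sub>j\<close> and \<open>p\<^sub>i - p\<^sub>j\<close>.\<close>
lemma linearized_F_selfadjoint:
  "(\<Sum>i\<in>{1..n}. m i * inner (linearized_F n m q w i) (p i))
     = (\<Sum>i\<in>{1..n}. m i * inner (w i) (linearized_F n m q p i))"
proof -
  define T where "T w p = (\<Sum>i\<in>{1..n}. \<Sum>j\<in>{1..n}. m i * m j *
      inner (inverse_cube_deriv (q i - q j) (w i - w j)) (p i))" for w p
  have exch: "T w p = (\<Sum>i\<in>{1..n}. \<Sum>j\<in>{1..n}. m i * m j *
      inner (inverse_cube_deriv (q i - q j) (w i - w j)) (- p j))" for w p
  proof -
    have flip: "inverse_cube_deriv (q j - q i) (w j - w i) = - inverse_cube_deriv (q i - q j) (w i - w j)" for i j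
      using inverse_cube_deriv_minus_left[of "q i - q j" "w j - w i"]
        linear_neg[OF linear_inverse_cube_deriv, of "q i - q j" "w i - w j"] by simp
    show ?thesis
      unfolding T_def
      by (subst sum.swap, intro sum.cong refl, subst flip) (simp add: mult_ac)
  qed
  have double: "2 * T w p = (\<Sum>i\<in>{1..n}. \<Sum>j\<in>{1..n}. m i * m j *
      inner (inverse_cube_deriv (q i - q j) (w i - w j)) (p i - p j))" for w p
    unfolding mult_2
    by (subst (2) exch, unfold T_def)
       (simp add: inner_diff_right right_diff_distrib flip: sum.distrib)
  have T_sym: "T w p = T p w"
    using double[of w p] double[of p w]
    by (simp add: inverse_cube_deriv_selfadjoint[of _ _ "p _ - p _"] inner_commute[of "w _ - w _"])
  have "(\<Sum>i\<in>{1..n}. m i * inner (linearized_F n m q w i) (p i))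
      = (\<Sum>i\<in>{1..n}. m i * inner (w i) (p i)) - T w p" for w p
    by (simp add: linearized_F_def T_def inner_diff_left inner_sum_left right_diff_distrib
        sum_subtractf sum_distrib_left mult.assoc)
  note this[of w p] this[of p w]
  then show ?thesis using T_sym by (simp add: inner_commute)
qed

section \<open>Kernel vectors of square matrices\<close>
lemma inverts_mat_transpose:
  fixes A :: "'a::comm_ring_1 mat"
  assumes "inverts_mat A B" "inverts_mat B A" "A \<in> carrier_mat N N"
  shows "inverts_mat (transpose_mat B) (transpose_mat A)" "B \<in> carrier_mat N N"
proof -
  have "A * B = 1\<^sub>m N" "B * A = 1\<^sub>m (dim_row B)"
    using assms by (auto simp: inverts_mat_def)
  then have "dim_col (A * B) = N" "dim_col (B * A) = dim_row B"
    by simp_all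
  then show B: "B \<in> carrier_mat N N"
    using assms by auto
  show "inverts_mat (transpose_mat B) (transpose_mat A)"
    using assms B transpose_mult[of A N N B N] by (auto simp: inverts_mat_def)
qed

lemma not_invertible_mat_if_kernel:
  fixes A :: "'a::comm_ring_1 mat"
  assumes A: "A \<in> carrier_mat N N" and ker: "\<And>k. k < N \<Longrightarrow> (\<Sum>l<N. A $$ (k, l) * v l) = 0"
    and nz: "l < N" "v l \<noteq> 0"
  shows "\<not> invertible_mat A"
proof
  assume "invertible_mat A"
  then obtain B where AB: "inverts_mat A B" "inverts_mat B A"
    by (auto simp: invertible_mat_def)
  have B: "B \<in> carrier_mat N N"
    using inverts_mat_transpose(2)[OF AB A] .
  define V where "V = Matrix.vec N v"
  have V: "V \<in> carrier_vec N" by (simp add: V_def)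
  have "A *\<^sub>v V = 0\<^sub>v N"
    using A ker by (intro eq_vecI) (auto simp: V_def scalar_prod_def atLeast0LessThan)
  moreover have "(B * A) *\<^sub>v V = B *\<^sub>v (A *\<^sub>v V)"
    using A B V by simp
  moreover have "B * A = 1\<^sub>m N"
    using AB B by (simp add: inverts_mat_def)
  ultimately have "V = 0\<^sub>v N"
    using A B V by auto
  then have "vec_index V l = 0" using nz by simp
  then show False using nz by (simp add: V_def)
qed

lemma not_invertible_mat_if_left_kernel:
  fixes A :: "'a::comm_ring_1 mat"
  assumes A: "A \<in> carrier_mat N N" and ker: "\<And>l. l < N \<Longrightarrow> (\<Sum>k<N. v k * A $$ (k, l)) = 0"
    and nz: "k < N" "v k \<noteq> 0"
  shows "\<not> invertible_mat A"
proof
  assume "invertible_mat A"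
  then obtain B where "inverts_mat A B" "inverts_mat B A"
    by (auto simp: invertible_mat_def)
  with A inverts_mat_transpose[of A B N] inverts_mat_transpose[of B A N]
  have "invertible_mat (transpose_mat A)"
    unfolding invertible_mat_def by auto
  moreover have "\<not> invertible_mat (transpose_mat A)"
    using A ker nz by (intro not_invertible_mat_if_kernel[of _ N v k]) (auto simp: mult.commute[of "v _"])
  ultimately show False by blast
qed

section \<open>Slots and gauge-fixed fields\<close>
lemma distinct_rs_slots: "n \<ge> 3 \<Longrightarrow> distinct (rs_slots n)"
proof -
  have "distinct (concat (map (\<lambda>i. [(i, 1::3), (i, 2), (i, 3)]) xs))" if "distinct xs" for xs :: "nat list"
    using that by (induction xs) auto
  then show "n \<ge> 3 \<Longrightarrow> distinct (rs_slots n)"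
    by (auto simp: rs_slots_def)
qed

text \<open>The coordinates required to vanish are those that are missing from \<open>rs_slots\<close>; prescribing them
  fixes the rotational freedom. The condition is used for configurations as well as for vector fields.\<close>
definition gauge_fixed :: "nat \<Rightarrow> (nat \<Rightarrow> real^3) \<Rightarrow> bool" where
  "gauge_fixed n w \<longleftrightarrow> w (n-2) $ 3 = 0 \<and> w (n-1) $ 2 = 0 \<and> w (n-1) $ 3 = 0"

lemma set_rs_slots:
  assumes "n \<ge> 3"
  shows "set (rs_slots n) = Sigma {1..n-1} (\<lambda>_. UNIV) - {(n-2, 3), (n-1, 2), (n-1, 3)}"
proof -
  have "s \<in> set (rs_slots n) \<longleftrightarrow> s \<in> Sigma {1..n-1} (\<lambda>_. UNIV) - {(n-2, 3), (n-1, 2), (n-1, 3)}" for s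
  proof (cases s)
    case (Pair i c)
    obtain k where n: "n = k + 3"
      using assms by (metis le_add_diff_inverse2)
    have "c = 1 \<or> c = 2 \<or> c = 3" by (rule exhaust_3)
    then show ?thesis
      unfolding Pair n rs_slots_def by (elim disjE) auto
  qed
  then show ?thesis by blast
qed

lemma gauge_fixed_coords_eq_0:
  assumes "n \<ge> 3" "gauge_fixed n w" "i \<in> {1..n-1}" "(i, c) \<notin> set (rs_slots n)"
  shows "w i $ c = 0"
  using assms by (auto simp: set_rs_slots gauge_fixed_def)

text \<open>The missing slots contribute nothing for a gauge-fixed field. Hence a combination of
  the kept rows of a derivative is a combination of full inner products over the bodies.\<close>
lemma sum_rs_slots_eq_inner:
  assumes "n \<ge> 3" "gauge_fixed n p"
  shows "(\<Sum>(i, c)\<in>set (rs_slots n). a i * (p i $ c * f i $ c)) = (\<Sum>i\<in>{1..n-1}. a i * inner (p i) (f i))"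
proof -
  have "(\<Sum>(i, c)\<in>set (rs_slots n). a i * (p i $ c * f i $ c))
      = (\<Sum>(i, c)\<in>Sigma {1..n-1} (\<lambda>_. UNIV). a i * (p i $ c * f i $ c))"
  proof (rule sum.mono_neutral_left)
    show "set (rs_slots n) \<subseteq> Sigma {1..n-1} (\<lambda>_. UNIV)"
      using assms(1) by (auto simp: set_rs_slots)
  qed (use gauge_fixed_coords_eq_0[OF assms] in auto)
  also have "\<dots> = (\<Sum>i\<in>{1..n-1}. \<Sum>c\<in>UNIV. a i * (p i $ c * f i $ c))"
    by (subst sum.Sigma) auto
  finally show ?thesis
    by (simp add: inner_vec_def sum_distrib_left)
qed

lemma sum_rs_slots_nth:
  "n \<ge> 3 \<Longrightarrow> (\<Sum>l<3 * n - 6. f (rs_slots n ! l)) = (\<Sum>s\<in>set (rs_slots n). f s)"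
  using distinct_rs_slots[of n]
  by (simp add: sum.distinct_set_conv_list sum_list_sum_nth length_rs_slots atLeast0LessThan)

section \<open>Motions in terms of the unknowns\<close>
lemma last_body_cong:
  "(\<And>i. i \<in> {1..n-1} \<Longrightarrow> w i = w' i) \<Longrightarrow> last_body n m w = last_body n m w'"
  unfolding last_body_def by (auto intro!: sum.cong)

text \<open>All bodies as a function of the unknowns, the last one supplied by the centre of mass. The map
  is linear in the unknowns, so it also sends an infinitesimal change of the unknowns to the velocity
  field that it causes.\<close>
definition rs_motion :: "nat \<Rightarrow> (nat \<Rightarrow> real) \<Rightarrow> (nat \<times> 3 \<Rightarrow> real) \<Rightarrow> nat \<Rightarrow> real^3" where
  "rs_motion n m u = (rs_embed n u)(n := last_body n m (rs_embed n u))"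

abbreviation unit_slot :: "nat \<times> 3 \<Rightarrow> nat \<times> 3 \<Rightarrow> real" where
  "unit_slot s \<equiv> (\<lambda>s'. of_bool (s' = s))"

lemma rs_motion_last:
  assumes "n \<ge> 3"
  shows "rs_motion n m u n = last_body n m (rs_motion n m u)"
proof -
  have "last_body n m (rs_motion n m u) = last_body n m (rs_embed n u)"
    using assms by (intro last_body_cong) (auto simp: rs_motion_def)
  then show ?thesis
    by (simp add: rs_motion_def)
qed

lemma rs_motion_update:
  "rs_motion n m (u(s := t)) j = rs_motion n m u j + (t - u s) *\<^sub>R rs_motion n m (unit_slot s) j"
proof -
  have embed: "rs_embed n (u(s := t)) i = rs_embed n u i + (t - u s) *\<^sub>R rs_embed n (unit_slot s) i" for i
    by (auto simp: rs_embed_def Finite_Cartesian_Product.vec_eq_iff)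
  show ?thesis
    by (simp add: rs_motion_def last_body_def embed scaleR_add_right sum.distrib scaleR_sum_right mult_ac)
qed

lemma rs_motion_eq_sum:
  "rs_motion n m u j = (\<Sum>s\<in>set (rs_slots n). u s *\<^sub>R rs_motion n m (unit_slot s) j)"
proof -
  have embed: "rs_embed n u i = (\<Sum>s\<in>set (rs_slots n). u s *\<^sub>R rs_embed n (unit_slot s) i)" for i
    by (auto simp: rs_embed_def Finite_Cartesian_Product.vec_eq_iff of_bool_def if_distrib[of "(*) _"] cong: if_cong)
  have "last_body n m (rs_embed n u) = (\<Sum>s\<in>set (rs_slots n). u s *\<^sub>R last_body n m (rs_embed n (unit_slot s)))"
    unfolding last_body_def embed scaleR_sum_right
    by (subst sum.swap) (simp add: mult_ac)
  with embed show ?thesis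
    by (simp add: rs_motion_def)
qed

text \<open>Gauge-fixed fields with centre of mass at the origin are exactly what the unknowns describe.\<close>
lemma rs_motion_coords:
  assumes "n \<ge> 3" "gauge_fixed n w" "w n = last_body n m w" "j \<in> {1..n}"
  shows "rs_motion n m (coords w) j = w j"
proof -
  have embed: "rs_embed n (coords w) i = w i" if "i \<in> {1..n-1}" for i
    using gauge_fixed_coords_eq_0[OF assms(1,2) that] by (auto simp: rs_embed_def coords_def Finite_Cartesian_Product.vec_eq_iff)
  then have "last_body n m (rs_embed n (coords w)) = last_body n m w"
    by (intro last_body_cong)
  with embed[of j] assms(3,4) show ?thesis
    by (auto simp: rs_motion_def)
qed

lemma F_cong: "(\<And>j. j \<in> {1..n} \<Longrightarrow> q j = q' j) \<Longrightarrow> i \<in> {1..n} \<Longrightarrow> F n m q i = F n m q' i"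
  unfolding F_def by (auto intro!: arg_cong2[where f = minus] sum.cong)

lemma linearized_F_cong:
  "(\<And>j. j \<in> {1..n} \<Longrightarrow> w j = w' j) \<Longrightarrow> i \<in> {1..n} \<Longrightarrow> linearized_F n m q w i = linearized_F n m q w' i"
  unfolding linearized_F_def by (auto intro!: arg_cong2[where f = minus] sum.cong)

lemma rs_lhs_eq_F: "rs_lhs n m u (i, c) = F n m (rs_motion n m u) i $ c"
  by (simp add: rs_lhs_def F_red_def rs_motion_def)

section \<open>Rotations and collinearity\<close>
lemma cross_sum_right: "\<omega> \<times> sum f A = (\<Sum>j\<in>A. \<omega> \<times> f j)"
  by (induction A rule: infinite_finite_induct) (simp_all add: cross_add_right)

lemma cross_last_body: "\<omega> \<times> last_body n m q = last_body n m (\<lambda>j. \<omega> \<times> q j)"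
  by (simp add: last_body_def cross_sum_right cross_mult_right)

lemma collinear_if_cross_eq_0:
  assumes "\<omega> \<noteq> 0" "\<And>i. i \<in> A \<Longrightarrow> \<omega> \<times> (q i - a) = 0"
  shows "collinear (q ` A)"
proof -
  have "\<exists>c. q i = a + c *\<^sub>R \<omega>" if i: "i \<in> A" for i
  proof -
    have "\<exists>c. q i - a = c *\<^sub>R \<omega>"
      using assms(1) assms(2)[OF i] by (auto simp: cross_eq_0 collinear_lemma intro: exI[of _ 0])
    then show ?thesis
      by (auto simp: algebra_simps)
  qed
  then show ?thesis
    unfolding collinear_alt by blast
qed

section \<open>Gauge-fixed central configurations\<close>
locale gauge_fixed_central_configuration =
  fixes n :: nat and q :: "nat \<Rightarrow> real^3" and m :: "nat \<Rightarrow> real"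
  assumes three_bodies: "n \<ge> 3"
    and central: "normalized_central_configuration n q m"
    and gauge: "gauge_fixed n q"
begin

lemma mass_pos: "i \<in> {1..n} \<Longrightarrow> m i > 0"
  and distinct_bodies: "inj_on q {1..n}"
  and F_zero: "i \<in> {1..n} \<Longrightarrow> F n m q i = 0"
  using central by (auto simp: normalized_central_configuration_def is_configuration_def)

lemma split_last_body: "(\<Sum>i\<in>{1..n}. f i) = (\<Sum>i\<in>{1..n-1}. f i) + f n"
  for f :: "nat \<Rightarrow> 'a::comm_monoid_add"
  using three_bodies sum.cl_ivl_Suc[of f 1 "n - 1"] by simp

lemma eq_last_body_iff: "w n = last_body n m w \<longleftrightarrow> (\<Sum>i\<in>{1..n}. m i *\<^sub>R w i) = 0"
proof -
  have "m n > 0" using mass_pos three_bodies by simp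
  then have "w n = last_body n m w \<longleftrightarrow> m n *\<^sub>R w n = m n *\<^sub>R last_body n m w"
    by simp
  also have "m n *\<^sub>R last_body n m w = - (\<Sum>i\<in>{1..n-1}. m i *\<^sub>R w i)"
    using \<open>m n > 0\<close> by (simp add: last_body_def)
  finally show ?thesis
    by (simp only: split_last_body) (simp add: eq_neg_iff_add_eq_0 add.commute)
qed

text \<open>The mutual attractions cancel in pairs, so the forces weighted by the masses add up to
  the sum of \<open>m\<^sub>i q\<^sub>i\<close>, and the forces are zero.\<close>
lemma center_of_mass: "(\<Sum>i\<in>{1..n}. m i *\<^sub>R q i) = 0"
proof -
  define X where "X = (\<Sum>i\<in>{1..n}. \<Sum>j\<in>{1..n}. (m i * m j / norm (q i - q j) ^ 3) *\<^sub>R (q i - q j))"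
  have "X = (\<Sum>i\<in>{1..n}. \<Sum>j\<in>{1..n}. - ((m i * m j / norm (q i - q j) ^ 3) *\<^sub>R (q i - q j)))"
    unfolding X_def
    by (subst sum.swap, intro sum.cong refl) (simp add: norm_minus_commute mult.commute flip: scaleR_minus_right)
  then have "X = - X"
    by (simp add: X_def sum_negf)
  then have "2 *\<^sub>R X = 0"
    by (simp only: scaleR_2 eq_neg_iff_add_eq_0)
  then have "X = 0" by simp
  have "(\<Sum>i\<in>{1..n}. m i *\<^sub>R F n m q i) = (\<Sum>i\<in>{1..n}. m i *\<^sub>R q i) - X"
    by (simp add: F_eq_sum_all X_def scaleR_right_diff_distrib sum_subtractf scaleR_sum_right)
  moreover have "(\<Sum>i\<in>{1..n}. m i *\<^sub>R F n m q i) = 0"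
    by (intro sum.neutral) (simp add: F_zero)
  ultimately show ?thesis
    using \<open>X = 0\<close> by (metis diff_zero)
qed

lemma last_body_eq: "q n = last_body n m q"
  by (simp add: eq_last_body_iff center_of_mass del: One_nat_def)

lemma rs_solution: "rs_solution n q m"
proof -
  have "rs_lhs n m (coords q) s = 0" if "s \<in> set (rs_slots n)" for s
  proof (cases s)
    case (Pair i c)
    with that have "i \<in> {1..n}" by (auto simp: set_rs_slots[OF three_bodies])
    then show ?thesis
      using F_cong[of n "rs_motion n m (coords q)" q i m] F_zero
        rs_motion_coords[OF three_bodies gauge last_body_eq]
      by (simp add: Pair rs_lhs_eq_F)
  qed
  then show ?thesis
    using central gauge last_body_eq
    by (simp add: rs_solution_def normalized_central_configuration_def gauge_fixed_def)
qed

text \<open>Varying a single unknown moves the bodies along straight lines, so the partial derivative is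
  the linearized force applied to the constant velocity field of that unknown.\<close>
lemma rs_jacobian_entry:
  assumes "k < 3 * n - 6" "l < 3 * n - 6" "rs_slots n ! k = (i, c)"
  shows "rs_jacobian n m (coords q) $$ (k, l)
    = linearized_F n m q (rs_motion n m (unit_slot (rs_slots n ! l))) i $ c"
proof -
  define s where "s = rs_slots n ! l"
  define w where "w = rs_motion n m (unit_slot s)"
  have "(i, c) \<in> set (rs_slots n)"
    using assms length_rs_slots[OF three_bodies] by (metis nth_mem)
  then have i: "i \<in> {1..n}"
    by (auto simp: set_rs_slots[OF three_bodies])
  have "rs_lhs n m ((coords q)(s := t)) (i, c) = F n m (\<lambda>j. q j + (t - coords q s) *\<^sub>R w j) i $ c" for t
    unfolding rs_lhs_eq_F
    by (subst F_cong[OF _ i])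
       (auto simp: rs_motion_update w_def rs_motion_coords[OF three_bodies gauge last_body_eq])
  moreover have "((\<lambda>t. F n m (\<lambda>j. q j + (t - coords q s) *\<^sub>R w j) i $ c)
      has_real_derivative linearized_F n m q w i $ c) (at (coords q s))"
    unfolding has_real_derivative_iff_has_vector_derivative
    by (intro bounded_linear.has_vector_derivative[OF bounded_linear_vec_nth]
        F_has_vector_derivative distinct_bodies i)
  ultimately have "deriv (\<lambda>t. rs_lhs n m ((coords q)(s := t)) (i, c)) (coords q s)
      = linearized_F n m q w i $ c"
    by (simp add: DERIV_imp_deriv)
  then show ?thesis
    using assms by (simp add: rs_jacobian_def s_def w_def)
qed

lemma degenerateI: "\<not> invertible_mat (rs_jacobian n m (coords q)) \<Longrightarrow> degenerate_rs_solution n q m"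
  using rs_solution by (simp add: degenerate_rs_solution_def nondegenerate_rs_solution_def)

lemma rs_jacobian_carrier: "rs_jacobian n m u \<in> carrier_mat (3 * n - 6) (3 * n - 6)"
  by (simp add: rs_jacobian_def)

lemma nonzero_slot:
  assumes "gauge_fixed n w" "i \<in> {1..n-1}" "w i \<noteq> 0"
  obtains l c where "l < 3 * n - 6" "rs_slots n ! l = (i, c)" "w i $ c \<noteq> 0"
proof -
  from assms(3) obtain c where c: "w i $ c \<noteq> 0"
    by (auto simp: Finite_Cartesian_Product.vec_eq_iff)
  with gauge_fixed_coords_eq_0[OF three_bodies assms(1,2)] have "(i, c) \<in> set (rs_slots n)"
    by blast
  with c that show thesis
    by (metis in_set_conv_nth length_rs_slots three_bodies)
qed

lemma slot_body: "k < 3 * n - 6 \<Longrightarrow> rs_slots n ! k = (i, c) \<Longrightarrow> i \<in> {1..n-1}"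
  using nth_mem[of k "rs_slots n"] by (auto simp: length_rs_slots set_rs_slots three_bodies)

text \<open>A rotation field that respects the gauge is a motion of the unknowns which does not change
  the forces to first order: its coordinates are a kernel vector of the Jacobian matrix.\<close>
lemma degenerate_if_gauge_fixed_rotation:
  assumes fixed: "gauge_fixed n (\<lambda>j. \<omega> \<times> q j)" and nz: "i \<in> {1..n-1}" "\<omega> \<times> q i \<noteq> 0"
  shows "degenerate_rs_solution n q m"
proof (rule degenerateI)
  define w where "w = (\<lambda>j. \<omega> \<times> q j)"
  obtain l c where l: "l < 3 * n - 6" "rs_slots n ! l = (i, c)" "w i $ c \<noteq> 0"
    using nonzero_slot[of w i] assms by (auto simp: w_def)
  have wn: "w n = last_body n m w"
    by (simp add: w_def last_body_eq flip: cross_last_body)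
  show "\<not> invertible_mat (rs_jacobian n m (coords q))"
  proof (rule not_invertible_mat_if_kernel[OF rs_jacobian_carrier _ l(1)])
    show "coords w (rs_slots n ! l) \<noteq> 0"
      using l by (simp add: coords_def)
    fix k assume k: "k < 3 * n - 6"
    obtain i' c' where s: "rs_slots n ! k = (i', c')" by fastforce
    have i': "i' \<in> {1..n}" using slot_body[OF k s] by auto
    have "(\<Sum>l<3 * n - 6. rs_jacobian n m (coords q) $$ (k, l) * coords w (rs_slots n ! l))
        = (\<Sum>l<3 * n - 6. coords w (rs_slots n ! l) *
            linearized_F n m q (rs_motion n m (unit_slot (rs_slots n ! l))) i' $ c')"
      by (intro sum.cong refl) (simp add: rs_jacobian_entry[OF k _ s])
    also have "\<dots> = (\<Sum>s\<in>set (rs_slots n). coords w s *\<^sub>R linearized_F n m q (rs_motion n m (unit_slot s)) i') $ c'"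
      by (subst sum_rs_slots_nth[OF three_bodies]) simp
    also have "\<dots> = linearized_F n m q (rs_motion n m (coords w)) i' $ c'"
      by (simp flip: linearized_F_sum rs_motion_eq_sum)
    also have "\<dots> = linearized_F n m q w i' $ c'"
      using fixed
      by (subst linearized_F_cong[OF rs_motion_coords[OF three_bodies _ wn] i']) (simp_all add: w_def)
    also have "\<dots> = 0"
      by (simp add: w_def linearized_F_rotation[OF i'] F_zero[OF i'])
    finally show "(\<Sum>l<3 * n - 6. rs_jacobian n m (coords q) $$ (k, l) * coords w (rs_slots n ! l)) = 0" .
  qed
qed

text \<open>By self-adjointness, \<open>p\<^sub>j = \<eta> \<times> (q\<^sub>j - q\<^sub>n)\<close> pairs with the linearized forces of a motion \<open>w\<close> to the same
  value as \<open>w\<close> pairs with the linearized forces of \<open>p\<close>. The latter are the constant \<open>- \<eta> \<times> q\<^sub>n\<close>, since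
  the rotation part contributes zero, and this pairing vanishes because \<open>w\<close> keeps the centre of mass
  fixed. As \<open>p\<^sub>n = 0\<close>, the row of the eliminated body does not occur, and the weights \<open>m\<^sub>i p\<^sub>i\<close> form
  a left kernel vector.\<close>
lemma degenerate_if_gauge_fixed_torque:
  assumes fixed: "gauge_fixed n (\<lambda>j. \<eta> \<times> (q j - q n))" and nz: "i \<in> {1..n-1}" "\<eta> \<times> (q i - q n) \<noteq> 0"
  shows "degenerate_rs_solution n q m"
proof (rule degenerateI)
  define p where "p = (\<lambda>j. \<eta> \<times> (q j - q n))"
  define v where "v = (\<lambda>(i, c). m i * (p i $ c))"
  obtain k c where k: "k < 3 * n - 6" "rs_slots n ! k = (i, c)" "p i $ c \<noteq> 0"
    using nonzero_slot[of p i] assms by (auto simp: p_def)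
  have p: "linearized_F n m q p j = - (\<eta> \<times> q n)" if "j \<in> {1..n}" for j
    by (simp add: p_def Cross3.right_diff_distrib linearized_F_diff linearized_F_translation
        linearized_F_rotation[OF that] F_zero[OF that])
  have orth: "(\<Sum>i\<in>{1..n-1}. m i * inner (p i) (linearized_F n m q w i)) = 0"
    if "w n = last_body n m w" for w
  proof -
    have "(\<Sum>i\<in>{1..n-1}. m i * inner (p i) (linearized_F n m q w i))
        = (\<Sum>i\<in>{1..n}. m i * inner (linearized_F n m q w i) (p i))"
      by (subst split_last_body) (simp add: p_def inner_commute)
    also have "\<dots> = (\<Sum>i\<in>{1..n}. m i * inner (w i) (- (\<eta> \<times> q n)))"
      unfolding linearized_F_selfadjoint by (intro sum.cong refl) (simp add: p)
    also have "\<dots> = inner (\<Sum>i\<in>{1..n}. m i *\<^sub>R w i) (- (\<eta> \<times> q n))"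
      by (simp add: inner_sum_left sum_negf)
    finally show ?thesis
      using that by (simp add: eq_last_body_iff)
  qed
  show "\<not> invertible_mat (rs_jacobian n m (coords q))"
  proof (rule not_invertible_mat_if_left_kernel[OF rs_jacobian_carrier _ k(1)])
    have "m i > 0" using mass_pos nz(1) by auto
    then show "v (rs_slots n ! k) \<noteq> 0"
      using k by (simp add: v_def)
    fix l assume l: "l < 3 * n - 6"
    define w where "w = rs_motion n m (unit_slot (rs_slots n ! l))"
    have wn: "w n = last_body n m w"
      unfolding w_def by (rule rs_motion_last[OF three_bodies])
    have "(\<Sum>k<3 * n - 6. v (rs_slots n ! k) * rs_jacobian n m (coords q) $$ (k, l))
        = (\<Sum>k<3 * n - 6. (\<lambda>(i, c). m i * (p i $ c * linearized_F n m q w i $ c)) (rs_slots n ! k))"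
      by (intro sum.cong refl) (auto simp: v_def w_def rs_jacobian_entry l split: prod.split)
    also have "\<dots> = (\<Sum>i\<in>{1..n-1}. m i * inner (p i) (linearized_F n m q w i))"
      using fixed unfolding sum_rs_slots_nth[OF three_bodies]
      by (intro sum_rs_slots_eq_inner[OF three_bodies]) (simp add: p_def)
    also have "\<dots> = 0"
      by (rule orth[OF wn])
    finally show "(\<Sum>k<3 * n - 6. v (rs_slots n ! k) * rs_jacobian n m (coords q) $$ (k, l)) = 0" .
  qed
qed

lemma bodies_distinct: "i \<in> {1..n} \<Longrightarrow> j \<in> {1..n} \<Longrightarrow> i \<noteq> j \<Longrightarrow> q i \<noteq> q j"
  using distinct_bodies by (auto dest: inj_onD)

end

theorem theorem12:
  fixes n :: nat and q :: "nat \<Rightarrow> real^3" and m :: "nat \<Rightarrow> real"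
  assumes "n \<ge> 3"
    and "normalized_central_configuration n q m"
    and "q (n-1) $ 2 = 0" and "q (n-1) $ 3 = 0" and "q (n-2) $ 3 = 0"
  shows "(q (n-1) $ 1 = q n $ 1 \<or> q (n-1) $ 1 = 0 \<longrightarrow> degenerate_rs_solution n q m) \<and>
    (q (n-2) $ 2 = 0 \<and> \<not> collinear (q ` {1..n}) \<longrightarrow> degenerate_rs_solution n q m) \<and>
    (Determinants.det (vector [vector [q (n-2) $ 2 - q n $ 2, q (n-1) $ 2 - q n $ 2],
                               vector [q (n-2) $ 1 - q n $ 1, q (n-1) $ 1 - q n $ 1]] :: real^2^2) = 0
       \<and> \<not> collinear (q ` {1..n}) \<longrightarrow> degenerate_rs_solution n q m)"
proof -
  interpret gauge_fixed_central_configuration n q m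
    using assms by unfold_locales (auto simp: gauge_fixed_def)
  have bodies: "n - 1 \<in> {1..n-1}" "n - 2 \<in> {1..n-1}"
    using assms(1) by auto
  have distinct_pair: "q (n-2) \<noteq> q (n-1)"
    using assms(1) by (intro bodies_distinct) auto
  then have planar: "q (n-2) $ 1 \<noteq> q (n-1) $ 1 \<or> q (n-2) $ 2 \<noteq> 0"
    using assms(3-5) by (auto simp: Finite_Cartesian_Product.vec_eq_iff forall_3)

  have equal_x: "degenerate_rs_solution n q m" if x: "q (n-1) $ 1 = q n $ 1"
  proof -
    have fixed: "gauge_fixed n (\<lambda>j. axis 3 1 \<times> (q j - q n))"
      using x by (simp add: gauge_fixed_def cross_components axis_def)
    \<comment> \<open>If both were zero, bodies \<open>n-2\<close> and \<open>n-1\<close> would lie on one parallel to the z-axis through \<open>q\<^sub>n\<close>.\<close>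
    have "axis 3 1 \<times> (q (n-1) - q n) \<noteq> 0 \<or> axis 3 1 \<times> (q (n-2) - q n) \<noteq> 0"
      using planar assms(3)
      by (auto simp: Finite_Cartesian_Product.vec_eq_iff forall_3 cross_components axis_def)
    then show ?thesis
      using degenerate_if_gauge_fixed_torque[OF fixed] bodies by blast
  qed

  have zero_x: "degenerate_rs_solution n q m" if x: "q (n-1) $ 1 = 0"
  proof (rule degenerate_if_gauge_fixed_rotation)
    show "gauge_fixed n (\<lambda>j. axis 3 1 \<times> q j)"
      using x by (simp add: gauge_fixed_def cross_components axis_def)
    show "axis 3 1 \<times> q (n-2) \<noteq> 0"
      using planar x
      by (auto simp: Finite_Cartesian_Product.vec_eq_iff forall_3 cross_components axis_def)
  qed (rule bodies)

  have zero_y: "degenerate_rs_solution n q m"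
    if y: "q (n-2) $ 2 = 0" and nc: "\<not> collinear (q ` {1..n})"
  proof -
    have fixed: "gauge_fixed n (\<lambda>j. axis 1 1 \<times> q j)"
      using y assms(3-5) by (simp add: gauge_fixed_def cross_components axis_def)
    have "\<exists>i\<in>{1..n-1}. axis 1 1 \<times> q i \<noteq> 0"
    proof (rule ccontr)
      assume *: "\<not> (\<exists>i\<in>{1..n-1}. axis 1 1 \<times> q i \<noteq> 0)"
      then have "axis 1 1 \<times> q n = 0"
        unfolding last_body_eq cross_last_body by (simp add: last_body_def)
      with * have "axis 1 1 \<times> (q i - 0) = 0" if "i \<in> {1..n}" for i
        using that by (cases "i = n") auto
      then show False
        using nc collinear_if_cross_eq_0[of "axis 1 1" "{1..n}" q 0] by simp
    qed
    then show ?thesis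
      using degenerate_if_gauge_fixed_rotation[OF fixed] by blast
  qed

  have det_zero: "degenerate_rs_solution n q m"
    if det: "Determinants.det (vector [vector [q (n-2) $ 2 - q n $ 2, q (n-1) $ 2 - q n $ 2],
        vector [q (n-2) $ 1 - q n $ 1, q (n-1) $ 1 - q n $ 1]] :: real^2^2) = 0"
      and nc: "\<not> collinear (q ` {1..n})"
  proof -
    define d where "d = q (n-1) - q n"
    have "d \<noteq> 0"
      using bodies_distinct[of "n-1" n] assms(1) by (auto simp: d_def)
    \<comment> \<open>The field vanishes at body \<open>n-1\<close>, and its z-coordinate at body \<open>n-2\<close> is the determinant up to sign.\<close>
    have fixed: "gauge_fixed n (\<lambda>j. d \<times> (q j - q n))"
      using det assms(3-5)
      by (simp add: gauge_fixed_def cross_components d_def det_2 algebra_simps)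
    obtain i where i: "i \<in> {1..n}" "d \<times> (q i - q n) \<noteq> 0"
      using collinear_if_cross_eq_0[OF \<open>d \<noteq> 0\<close>, of "{1..n}" q "q n"] nc by auto
    then have "i \<noteq> n" by auto
    with i have "i \<in> {1..n-1}" by auto
    with i(2) show ?thesis
      using degenerate_if_gauge_fixed_torque[OF fixed] by blast
  qed

  show ?thesis
    using equal_x zero_x zero_y det_zero by blast
qed

end
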